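(* For every integer $n\ge0$ let $$P_n=P_n(q)=\sum_{j\ge0}\sum_{k\ge0}q^{j(j+1)/2+k}\begin{bmatrix} j+k-1\\ k\end{bmatrix}_{q^2}\begin{bmatrix} n-2k\\ j\end{bmatrix}_{q}.$$ Then $$P_n=\sum_{k=-\infty}^\infty\Big[q^{(21k^2+k)/2}\,T_1(n+1,7k;\sqrt q)-q^{(21k^2+13k+2)/2}\,T_1(n+1,7k+2;\sqrt q)\Big],$$ and $P_0=1$, $P_1=q+1$, $P_2=q^3+q^2+q+1$, and $P_n=(1+q^n)P_{n-1}+qP_{n-2}-qP_{n-3}$ for $n\ge3$.
   Context: $q$ is an indeterminate with a formal square root $\sqrt q$. $(a;p)_n=\prod_{i=0}^{n-1}(1-ap^i)$. The Gaussian polynomial in base $p$ is $\begin{bmatrix} A\\ B\end{bmatrix}_{p}=\frac{(p;p)_A}{(p;p)_B(p;p)_{A-B}}$ if $0\le B\le A$, and $0$ otherwise; the only exception is that the factor $\begin{bmatrix} j+k-1\\ k\end{bmatrix}_{q^2}$ is taken to be $1$ when $j=k=0$. For integers $L\ge0$ and $A$, $$T_1(L,A;q)=\sum_{r=0}^L(-q)^r\begin{bmatrix} L\\ r\end{bmatrix}_{q^2}\begin{bmatrix} 2L-2r\\ L-A-r\end{bmatrix}_{q},$$ and $T_1(L,A;\sqrt q)$ is obtained by replacing $q$ by $\sqrt q$. All sums have only finitely many nonzero terms. *)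

theory Defs
  imports "HOL-Computational_Algebra.Computational_Algebra" "HOL-Library.Groups_Big_Fun"
begin

definition qpochhammer :: "'a::field \<Rightarrow> 'a \<Rightarrow> nat \<Rightarrow> 'a" where
  "qpochhammer a p n = (\<Prod>i<n. 1 - a * p ^ i)"

(* Used only at bases p that are not roots of unity, so the denominator does not vanish. *)
definition gauss_poly :: "'a::field \<Rightarrow> int \<Rightarrow> int \<Rightarrow> 'a" where
  "gauss_poly p A B =
     (if 0 \<le> B \<and> B \<le> A
      then qpochhammer p p (nat A) / (qpochhammer p p (nat B) * qpochhammer p p (nat (A - B)))
      else 0)"

definition T1 :: "nat \<Rightarrow> int \<Rightarrow> 'a::field \<Rightarrow> 'a" where
  "T1 L A q = (\<Sum>r=0..L. (- q) ^ r * gauss_poly (q ^ 2) (int L) (int r)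
                 * gauss_poly q (2 * int L - 2 * int r) (int L - A - int r))"

definition Pfactor :: "'a::field \<Rightarrow> nat \<Rightarrow> nat \<Rightarrow> 'a" where
  "Pfactor p j k = (if j = 0 \<and> k = 0 then 1 else gauss_poly p (int j + int k - 1) (int k))"

definition Pterm :: "'a::field \<Rightarrow> nat \<Rightarrow> nat \<Rightarrow> nat \<Rightarrow> 'a" where
  "Pterm q n j k = q ^ (j * (j + 1) div 2 + k) * Pfactor (q ^ 2) j k
                     * gauss_poly q (int n - 2 * int k) (int j)"

(* Sum_any is 0 on a family of infinite support; finiteness of the supports is proved below. *)
definition P :: "'a::field \<Rightarrow> nat \<Rightarrow> 'a" where
  "P q n = Sum_any (\<lambda>j. Sum_any (\<lambda>k. Pterm q n j k))"

(* sqrt_q is the indeterminate of Q(sqrt q), and q is its square. *)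
definition sqrt_q :: "rat poly fract" where
  "sqrt_q = Fract [:0, 1:] 1"

definition q_ind :: "rat poly fract" where
  "q_ind = sqrt_q ^ 2"

lemma gauss_poly_eq_0: "\<not> (0 \<le> B \<and> B \<le> A) \<Longrightarrow> gauss_poly p A B = 0"
  by (simp only: gauss_poly_def if_False)

lemma Pterm_eq_0: "n < j + 2 * k \<Longrightarrow> Pterm q n j k = 0"
  by (simp add: Pterm_def gauss_poly_eq_0)

lemma finite_Pterm_support: "finite {(j, k). Pterm q n j k \<noteq> 0}"
proof (rule finite_subset)
  show "{(j, k). Pterm q n j k \<noteq> 0} \<subseteq> {..n} \<times> {..n}"
  proof clarify
    fix j k assume "Pterm q n j k \<noteq> 0"
    then have "\<not> n < j + 2 * k" using Pterm_eq_0 by blast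
    then show "j \<in> {..n} \<and> k \<in> {..n}" by simp
  qed
qed simp

lemma T1_eq_0:
  assumes "int L < \<bar>A\<bar>" shows "T1 L A q = 0"
  unfolding T1_def
proof (rule sum.neutral, rule ballI)
  fix r assume "r \<in> {0..L}"
  then have "gauss_poly q (2 * int L - 2 * int r) (int L - A - int r) = 0"
    using assms by (intro gauss_poly_eq_0) auto
  then show "(- q) ^ r * gauss_poly (q ^ 2) (int L) (int r)
               * gauss_poly q (2 * int L - 2 * int r) (int L - A - int r) = 0"
    by simp
qed

lemma finite_bilateral_support:
  fixes f g :: "int \<Rightarrow> 'a::field"
  shows "finite {k. f k * T1 L (7 * k) q - g k * T1 L (7 * k + 2) q \<noteq> 0}"
proof (rule finite_subset)
  show "{k. f k * T1 L (7 * k) q - g k * T1 L (7 * k + 2) q \<noteq> 0} \<subseteq> {- int L - 1..int L + 1}"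
  proof (rule subsetI, rule ccontr)
    fix k
    assume k: "k \<in> {k. f k * T1 L (7 * k) q - g k * T1 L (7 * k + 2) q \<noteq> 0}"
    assume "k \<notin> {- int L - 1..int L + 1}"
    then have "int L < \<bar>7 * k\<bar>" "int L < \<bar>7 * k + 2\<bar>" by auto
    with k show False by (simp add: T1_eq_0)
  qed
qed simp

end

theory Submission
  imports Defs
begin

text \<open>
  Both sides are solutions of one third-order recurrence with the same initial values.

  For the double sum \<open>P\<close> the recurrence comes from its generating function
  \<open>G(z) = (\<Sum>j. q^(j(j+1)/2) z^j / ((z;q)_(j+1) (q z^2;q^2)_j))\<close>: multiplying the \<open>(j+1)\<close>-st
  summand by \<open>(1 - z) (1 - q z^2)\<close> gives \<open>z q\<close> times the \<open>j\<close>-th summand at \<open>z q\<close>, hence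
  \<open>(1 - z) (1 - q z^2) G(z) = 1 - q z^2 + z q G(z q)\<close>.  Below this is done coefficientwise: the
  coefficient of \<open>z^m\<close> in the \<open>j\<close>-th summand is, up to the power of \<open>q\<close> in front, \<open>column N j m\<close>,
  and the identity is \<open>column_Suc\<close>.

  For the bilateral sum put \<open>t = sqrt q\<close> and let \<open>T0\<close> be the second q-trinomial coefficient of
  Andrews and Baxter.  Three relations, \<open>T1_Suc\<close>, \<open>T0_Suc\<close> and \<open>T1_T0_exchange\<close>, follow from the
  Pascal rules for Gaussian polynomials.  The bilateral sum is
  \<open>S L = (\<Sum>k. t^(21k^2+k) T1(L,7k) - t^(21k^2+13k+2) T1(L,7k+2))\<close> at \<open>L = n + 1\<close>.  Its companion is
  \<open>V L = (\<Sum>k. t^(21k^2+8k) T0(L,7k+1) - t^(21k^2+20k+4) T0(L,7k+3))\<close>.  Summing the three relations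
  against the quadratic exponents, and using that \<open>T0\<close> and \<open>T1\<close> are even in their second argument
  to identify sums under \<open>k \<mapsto> - k\<close> and \<open>k \<mapsto> - 1 - k\<close>, one obtains the closed system
  \<open>S (L + 1) = S L + t^(L+1) V L\<close> and \<open>V (L + 2) = V L + t^(L+1) S (L + 2)\<close>
  (\<open>S_Suc\<close> and \<open>V_Suc_Suc\<close>).  Eliminating \<open>V\<close> yields the recurrence for \<open>S\<close>.

  Everything holds over any field for a base that is nonzero and not a root of unity; the
  indeterminate is such an element.
\<close>

section \<open>Gaussian polynomials\<close>

lemma gauss_symmetric: "gauss_poly p A B = gauss_poly p A (A - B)"
  by (auto simp: gauss_poly_def mult.commute)

locale generic_base =
  fixes t :: "'a::field"
  assumes nonzero: "t \<noteq> 0" and power_neq_1: "\<And>n. 0 < n \<Longrightarrow> t ^ n \<noteq> 1"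
begin

text \<open>
  All recurrences below rest on this rule and its mirror image under \<open>B \<mapsto> A - B\<close>: both Pascal
  rules and the comparison of neighbouring entries of a row are linear consequences of the two.
\<close>
lemma gauss_absorb:
  assumes A: "0 \<le> A"
  shows "(1 - t powi A) * gauss_poly t (A - 1) B = (1 - t powi (A - B)) * gauss_poly t A B"
proof (cases "0 \<le> B \<and> B < A")
  case True
  define a b where "a = nat (A - B) - 1" and "b = nat B"
  have A_eq: "A = int (Suc (a + b))" and B_eq: "B = int b"
    using True by (auto simp: a_def b_def)
  have poch_Suc: "qpochhammer t t (Suc n) = qpochhammer t t n * (1 - t ^ Suc n)" for n
    by (simp add: qpochhammer_def)
  have fac: "1 - t ^ Suc n \<noteq> 0" for n
    using power_neq_1[of "Suc n"] by auto
  have poch: "qpochhammer t t n \<noteq> 0" for n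
    unfolding qpochhammer_def using fac by (auto simp: power_Suc)
  have diffs: "nat (A - 1) = a + b" "nat (A - 1 - B) = a" "nat A = Suc (a + b)" "nat B = b"
    "nat (A - B) = Suc a" "A - B = int (Suc a)" "A - 1 = int (a + b)"
    using A_eq B_eq by auto
  have "gauss_poly t (A - 1) B = qpochhammer t t (a + b) / (qpochhammer t t b * qpochhammer t t a)"
    unfolding diffs(7) B_eq by (simp add: gauss_poly_def nat_int_add)
  moreover have "gauss_poly t A B =
      qpochhammer t t (a + b) * (1 - t ^ Suc (a + b)) /
      (qpochhammer t t b * (qpochhammer t t a * (1 - t ^ Suc a)))"
    using True by (simp add: gauss_poly_def diffs(3-5) poch_Suc del: power_Suc)
  moreover have "t powi A = t ^ Suc (a + b)" "t powi (A - B) = t ^ Suc a"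
    by (simp only: A_eq power_int_of_nat, simp only: diffs(6) power_int_of_nat)
  ultimately show ?thesis
    using fac[of a] poch by (simp del: power_Suc)
next
  case False
  then show ?thesis
    by (cases "A = B") (auto simp: gauss_poly_def)
qed

lemma gauss_absorb':
  assumes A: "0 \<le> A"
  shows "(1 - t powi A) * gauss_poly t (A - 1) (B - 1) = (1 - t powi B) * gauss_poly t A B"
  using gauss_absorb[OF A, of "A - B"]
  by (simp add: gauss_symmetric[of t "A - 1" "B - 1"] gauss_symmetric[of t A "A - B"])

lemma gauss_pascal:
  assumes A: "0 < A"
  shows "gauss_poly t A B = gauss_poly t (A - 1) B + t powi (A - B) * gauss_poly t (A - 1) (B - 1)"
proof -
  have "t powi A \<noteq> 1"
    using power_neq_1[of "nat A"] A by (auto simp: power_int_def)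
  then have nz: "1 - t powi A \<noteq> 0" by simp
  have "(1 - t powi A) * (gauss_poly t (A - 1) B + t powi (A - B) * gauss_poly t (A - 1) (B - 1))
      = (1 - t powi (A - B)) * gauss_poly t A B + t powi (A - B) * ((1 - t powi B) * gauss_poly t A B)"
    using gauss_absorb[of A B] gauss_absorb'[of A B] A
    by (simp add: distrib_left mult.left_commute[of "1 - t powi A"])
  also have "\<dots> = (1 - t powi (A - B) * t powi B) * gauss_poly t A B"
    by (simp add: algebra_simps)
  also have "t powi (A - B) * t powi B = t powi A"
    using nonzero by (simp flip: power_int_add)
  finally show ?thesis using nz by simp
qed

lemma gauss_pascal':
  assumes A: "0 < A"
  shows "gauss_poly t A B = gauss_poly t (A - 1) (B - 1) + t powi B * gauss_poly t (A - 1) B"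
  using gauss_pascal[OF A, of "A - B"]
  by (simp add: gauss_symmetric[of t A "A - B"] gauss_symmetric[of t "A - 1" "B - 1"]
      gauss_symmetric[of t "A - 1" B] algebra_simps)

lemma gauss_move:
  assumes A: "0 \<le> A"
  shows "(1 - t powi B) * gauss_poly t A B = (1 - t powi (A - B + 1)) * gauss_poly t A (B - 1)"
proof -
  have "A - (B - 1) = A - B + 1" by simp
  then show ?thesis
    using gauss_absorb[OF A, of "B - 1"] gauss_absorb'[OF A, of B] by metis
qed

text \<open>
  Two Pascal steps chosen so that the middle coefficient carries no \<open>A\<close>.  This is the recurrence
  \<open>\<Pi>(m+1) = \<Pi>(m) (1 + t^(2m+1) - (z + 1/z) t^(m+1/2))\<close> for the product
  \<open>\<Pi>(m) = (z t^(1/2);t)_m (t^(1/2)/z;t)_m\<close>, whose coefficients are, up to sign and a power of \<open>t\<close>,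
  the central Gaussian polynomials.
\<close>
lemma gauss_central_Suc:
  "gauss_poly t (2 * int m + 2) (int m + 1 - A) =
      (1 + t ^ (2 * m + 1)) * gauss_poly t (2 * int m) (int m - A)
      + t powi (int m + 1 + A) * gauss_poly t (2 * int m) (int m - A - 1)
      + t powi (int m + 1 - A) * gauss_poly t (2 * int m) (int m - A + 1)"
proof -
  let ?g = "gauss_poly t (2 * int m)" and ?h = "gauss_poly t (2 * int m + 1)"
  have "gauss_poly t (2 * int m + 2) (int m + 1 - A) =
      ?h (int m - A) + t powi (int m + 1 - A) * ?h (int m + 1 - A)"
    using gauss_pascal'[of "2 * int m + 2" "int m + 1 - A"] by (simp add: algebra_simps)
  also have "?h (int m - A) = ?g (int m - A) + t powi (int m + 1 + A) * ?g (int m - A - 1)"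
    using gauss_pascal[of "2 * int m + 1" "int m - A"] by (simp add: algebra_simps)
  also have "?h (int m + 1 - A) = ?g (int m - A + 1) + t powi (int m + A) * ?g (int m - A)"
    using gauss_pascal[of "2 * int m + 1" "int m + 1 - A"] by (simp add: algebra_simps)
  also have "t powi (int m + 1 - A) * (?g (int m - A + 1) + t powi (int m + A) * ?g (int m - A))
     = t powi (int m + 1 - A) * ?g (int m - A + 1) +
       t powi (int m + 1 - A + (int m + A)) * ?g (int m - A)"
    using nonzero by (subst power_int_add) (auto simp: algebra_simps)
  also have "int m + 1 - A + (int m + A) = int (2 * m + 1)"
    by simp
  also have "t powi int (2 * m + 1) = t ^ (2 * m + 1)"
    by (rule power_int_of_nat)
  finally show ?thesis by (simp add: algebra_simps)
qed

text \<open>Summation forms of the two Pascal rules and of \<open>gauss_move\<close>, for an arbitrary weight \<open>f\<close>.\<close>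
lemma sum_gauss_pascal:
  "(\<Sum>r=0..Suc L. gauss_poly t (int (Suc L)) (int r) * f r) =
         (\<Sum>r=0..L. gauss_poly t (int L) (int r) * (f r + t ^ (L - r) * f (Suc r)))"
proof -
  have "(\<Sum>r=0..Suc L. gauss_poly t (int (Suc L)) (int r) * f r) =
     (\<Sum>r=0..Suc L. gauss_poly t (int L) (int r) * f r) +
     (\<Sum>r=0..Suc L. t powi (int (Suc L) - int r) * gauss_poly t (int L) (int r - 1) * f r)"
    using gauss_pascal[of "int (Suc L)"] by (simp add: algebra_simps flip: sum.distrib)
  also have "(\<Sum>r=0..Suc L. gauss_poly t (int L) (int r) * f r) =
     (\<Sum>r=0..L. gauss_poly t (int L) (int r) * f r)"
    by (simp add: gauss_poly_eq_0)
  also have "(\<Sum>r=0..Suc L. t powi (int (Suc L) - int r) * gauss_poly t (int L) (int r - 1) * f r)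
     = (\<Sum>r=0..L. t powi (int L - int r) * gauss_poly t (int L) (int r) * f (Suc r))"
    by (subst sum.atLeast0_atMost_Suc_shift) (simp add: gauss_poly_eq_0)
  also have "\<dots> = (\<Sum>r=0..L. t ^ (L - r) * gauss_poly t (int L) (int r) * f (Suc r))"
    by (intro sum.cong) (auto simp: power_int_def nat_diff_distrib)
  finally show ?thesis by (simp add: algebra_simps flip: sum.distrib)
qed

lemma sum_gauss_pascal':
  "(\<Sum>r=0..Suc L. gauss_poly t (int (Suc L)) (int r) * f r) =
         (\<Sum>r=0..L. gauss_poly t (int L) (int r) * (t ^ r * f r + f (Suc r)))"
proof -
  have "(\<Sum>r=0..Suc L. gauss_poly t (int (Suc L)) (int r) * f r) =
     (\<Sum>r=0..Suc L. gauss_poly t (int L) (int r) * (t ^ r * f r)) +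
     (\<Sum>r=0..Suc L. gauss_poly t (int L) (int r - 1) * f r)"
    using gauss_pascal'[of "int (Suc L)"] by (simp add: algebra_simps flip: sum.distrib)
  also have "(\<Sum>r=0..Suc L. gauss_poly t (int L) (int r) * (t ^ r * f r)) =
     (\<Sum>r=0..L. gauss_poly t (int L) (int r) * (t ^ r * f r))"
    by (simp add: gauss_poly_eq_0)
  also have "(\<Sum>r=0..Suc L. gauss_poly t (int L) (int r - 1) * f r)
     = (\<Sum>r=0..L. gauss_poly t (int L) (int r) * f (Suc r))"
    by (subst sum.atLeast0_atMost_Suc_shift) (simp add: gauss_poly_eq_0)
  finally show ?thesis by (simp add: algebra_simps flip: sum.distrib)
qed

lemma sum_gauss_shift:
  "(\<Sum>r=0..L. gauss_poly t (int L) (int r) * ((1 - t ^ r) * f r)) =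
         (\<Sum>r=0..L. gauss_poly t (int L) (int r) * ((1 - t ^ (L - r)) * f (Suc r)))"
proof -
  have "(\<Sum>r=0..L. gauss_poly t (int L) (int r) * ((1 - t ^ r) * f r)) =
      (\<Sum>r=0..Suc L. (1 - t powi int r) * gauss_poly t (int L) (int r) * f r)"
    by (simp add: gauss_poly_eq_0 algebra_simps)
  also have "\<dots> = (\<Sum>r=0..L. (1 - t powi int (Suc r)) * gauss_poly t (int L) (int (Suc r)) * f (Suc r))"
    by (subst sum.atLeast0_atMost_Suc_shift) (simp del: of_nat_Suc)
  also have "\<dots> = (\<Sum>r=0..L. (1 - t powi (int L - int r)) * gauss_poly t (int L) (int r) * f (Suc r))"
    by (subst gauss_move) (simp_all add: algebra_simps)
  also have "\<dots> = (\<Sum>r=0..L. gauss_poly t (int L) (int r) * ((1 - t ^ (L - r)) * f (Suc r)))"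
    by (intro sum.cong) (auto simp: power_int_def nat_diff_distrib)
  finally show ?thesis .
qed

end

section \<open>Recurrences for the q-trinomial coefficients\<close>

definition T0 :: "nat \<Rightarrow> int \<Rightarrow> 'a::field \<Rightarrow> 'a" where
  "T0 L A q = (\<Sum>r=0..L. (- 1) ^ r * gauss_poly (q ^ 2) (int L) (int r)
                 * gauss_poly q (2 * int L - 2 * int r) (int L - A - int r))"

context generic_base
begin

lemma generic_base_square: "generic_base (t ^ 2)"
  using nonzero power_neq_1 by unfold_locales (auto simp flip: power_mult)

lemmas pascal_rules =
  generic_base.sum_gauss_pascal[OF generic_base_square]
  generic_base.sum_gauss_pascal'[OF generic_base_square]
  generic_base.sum_gauss_shift[OF generic_base_square]

abbreviation central :: "nat \<Rightarrow> int \<Rightarrow> 'a" where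
  "central m i \<equiv> gauss_poly t (2 * int m) (int m - i)"

lemma T1_central: "T1 L A t = (\<Sum>r=0..L. gauss_poly (t ^ 2) (int L) (int r) * ((- t) ^ r * central (L - r) A))"
  unfolding T1_def by (intro sum.cong) (auto simp: of_nat_diff algebra_simps)

lemma T0_central: "T0 L A t = (\<Sum>r=0..L. gauss_poly (t ^ 2) (int L) (int r) * ((- 1) ^ r * central (L - r) A))"
  unfolding T0_def by (intro sum.cong) (auto simp: of_nat_diff algebra_simps)

lemma central_minus: "central m (- A) = central m A"
  by (subst gauss_symmetric) simp

lemma T1_minus: "T1 L (- A) t = T1 L A t"
  unfolding T1_central central_minus ..

lemma T0_minus: "T0 L (- A) t = T0 L A t"
  unfolding T0_central central_minus ..

lemma T0_eq_0:
  assumes "int L < \<bar>A\<bar>" shows "T0 L A t = 0"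
  unfolding T0_central
proof (rule sum.neutral, rule ballI)
  fix r assume "r \<in> {0..L}"
  then have "central (L - r) A = 0"
    using assms by (intro gauss_poly_eq_0) auto
  then show "gauss_poly (t ^ 2) (int L) (int r) * ((- 1) ^ r * central (L - r) A) = 0"
    by simp
qed

lemma central_Suc:
  "central (Suc m) A = (1 + t ^ (2 * m + 1)) * central m A
     + t powi (int m + 1 + A) * central m (A + 1) + t powi (int m + 1 - A) * central m (A - 1)"
  using gauss_central_Suc[of m A] by (simp add: algebra_simps)

text \<open>
  With this choice of Pascal rule for the outer Gaussian polynomial, the extra term
  \<open>- t^(2m+1)\<close> cancels the one in the middle coefficient of \<open>central_Suc\<close>.
\<close>
lemma T1_Suc:
  "T1 (Suc L) A t = T1 L A t + t powi (int L + 1 + A) * T0 L (A + 1) t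
     + t powi (int L + 1 - A) * T0 L (A - 1) t"
proof -
  have scale: "g * x = g * a + p * (g * b) + s * (g * c)"
    if "x = a + p * b + s * c" for x a b c g p s :: 'a
    unfolding that by (simp add: algebra_simps)
  have "T1 (Suc L) A t =
      (\<Sum>r=0..L. gauss_poly (t ^ 2) (int L) (int r) *
          ((- t) ^ r * central (Suc L - r) A + (t ^ 2) ^ (L - r) * ((- t) ^ Suc r * central (L - r) A)))"
    unfolding T1_central pascal_rules(1) diff_Suc_Suc ..
  also have "\<dots> = (\<Sum>r=0..L. gauss_poly (t ^ 2) (int L) (int r) * ((- t) ^ r * central (L - r) A)
      + t powi (int L + 1 + A) * (gauss_poly (t ^ 2) (int L) (int r) * ((- 1) ^ r * central (L - r) (A + 1)))
      + t powi (int L + 1 - A) * (gauss_poly (t ^ 2) (int L) (int r) * ((- 1) ^ r * central (L - r) (A - 1))))"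
  proof (intro sum.cong refl)
    fix r assume "r \<in> {0..L}"
    then obtain m where L: "L = m + r" using nat_le_iff_add[of r L] by (auto simp: add.commute)
    have e1: "t powi (int L + 1 + A) = t ^ r * t powi (int m + 1 + A)"
      and e2: "t powi (int L + 1 - A) = t ^ r * t powi (int m + 1 - A)"
      using nonzero unfolding L by (simp_all add: algebra_simps flip: power_int_of_nat power_int_add)
    have s: "(- t) ^ r = (- 1) ^ r * t ^ r"
      by (rule power_minus)
    show "gauss_poly (t ^ 2) (int L) (int r) *
          ((- t) ^ r * central (Suc L - r) A + (t ^ 2) ^ (L - r) * ((- t) ^ Suc r * central (L - r) A)) =
        gauss_poly (t ^ 2) (int L) (int r) * ((- t) ^ r * central (L - r) A)
      + t powi (int L + 1 + A) * (gauss_poly (t ^ 2) (int L) (int r) * ((- 1) ^ r * central (L - r) (A + 1)))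
      + t powi (int L + 1 - A) * (gauss_poly (t ^ 2) (int L) (int r) * ((- 1) ^ r * central (L - r) (A - 1)))"
    proof -
      have d: "Suc L - r = Suc m" "L - r = m" using L by auto
      have "(- t) ^ r * central (Suc m) A + (t ^ 2) ^ m * ((- t) ^ Suc r * central m A) =
         (- t) ^ r * central m A + t powi (int L + 1 + A) * ((- 1) ^ r * central m (A + 1))
         + t powi (int L + 1 - A) * ((- 1) ^ r * central m (A - 1))"
        unfolding central_Suc e1 e2 power_Suc s power_add power_mult by (simp add: algebra_simps)
      then show ?thesis unfolding d by (rule scale)
    qed
  qed
  also have "\<dots> = T1 L A t + t powi (int L + 1 + A) * T0 L (A + 1) t
     + t powi (int L + 1 - A) * T0 L (A - 1) t"
    unfolding T1_central T0_central sum.distrib sum_distrib_left ..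
  finally show ?thesis .
qed

text \<open>
  Writing \<open>[a, b]\<close> for \<open>gauss_poly t a b\<close>, the relation holds summand by summand: with \<open>m = L - r\<close> it is
  \<open>(1 - t^(m-A)) [2m, m-A] = (1 - t^(m+A+1)) [2m, m-A-1]\<close>.
\<close>
lemma T1_T0_exchange:
  "T1 L A t + t powi (int L + A + 1) * T0 L (A + 1) t = T1 L (A + 1) t + t powi (int L - A) * T0 L A t"
proof -
  have "gauss_poly (t ^ 2) (int L) (int r) * ((- t) ^ r * central (L - r) A)
      + t powi (int L + A + 1) * (gauss_poly (t ^ 2) (int L) (int r) * ((- 1) ^ r * central (L - r) (A + 1)))
      = gauss_poly (t ^ 2) (int L) (int r) * ((- t) ^ r * central (L - r) (A + 1))
      + t powi (int L - A) * (gauss_poly (t ^ 2) (int L) (int r) * ((- 1) ^ r * central (L - r) A))"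
    if "r \<in> {0..L}" for r
  proof -
    from that obtain m where L: "L = m + r" using nat_le_iff_add[of r L] by (auto simp: add.commute)
    then have d: "L - r = m" by simp
    have e1: "t powi (int L + A + 1) = t ^ r * t powi (int m + A + 1)"
      and e2: "t powi (int L - A) = t ^ r * t powi (int m - A)"
      using nonzero unfolding L by (simp_all add: algebra_simps flip: power_int_of_nat power_int_add)
    have s: "(- t) ^ r = (- 1) ^ r * t ^ r"
      by (rule power_minus)
    have "(1 - t powi (int m - A)) * central m A = (1 - t powi (int m + A + 1)) * central m (A + 1)"
      using gauss_move[of "2 * int m" "int m - A"] by (simp add: algebra_simps)
    then have "central m A + t powi (int m + A + 1) * central m (A + 1) = central m (A + 1) + t powi (int m - A) * central m A"
      by (simp add: algebra_simps)
    then have "gauss_poly (t ^ 2) (int L) (int r) * (-1)^r * t^r * (central m A + t powi (int m + A + 1) * central m (A + 1))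
       = gauss_poly (t ^ 2) (int L) (int r) * (-1)^r * t^r * (central m (A + 1) + t powi (int m - A) * central m A)"
      by (rule arg_cong)
    then show ?thesis unfolding d e1 e2 s by (simp only: distrib_left mult_ac)
  qed
  then show ?thesis
    unfolding T1_central T0_central sum_distrib_left sum.distrib[symmetric] by (rule sum.cong[OF refl])
qed

text \<open>
  Here the two sides do not agree summand by summand.  After the Pascal step, and with \<open>[a, b]\<close>
  for \<open>gauss_poly t a b\<close>, their difference has the summands
  \<open>(1 - t^(2r)) [2m+1, m+1-A] + (1 - t^(m+A)) [2m, m-A]\<close> with \<open>m = L - r\<close>, up to a common
  weight; the first part equals the negative of the second after the shift \<open>r \<mapsto> r + 1\<close> of \<open>sum_gauss_shift\<close> and one
  absorption.
\<close>
lemma T0_Suc: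
  "T0 (Suc L) A t = T0 L (A - 1) t + t powi (int L + 1 + A) * T1 L A t
     + t powi (2 * int L + 2 + 2 * A) * T0 L (A + 1) t"
proof -
  let ?g = "\<lambda>r. gauss_poly (t ^ 2) (int L) (int r)"
  \<comment> \<open>At \<open>m = 0\<close> the upper index is \<open>-1\<close> and \<open>h m = 0\<close>, which is consistent with absorption.\<close>
  define h where "h m = gauss_poly t (2 * int m - 1) (int m - A)" for m :: nat
  have h_Suc: "h (Suc m) = central m (A - 1) + t powi (int m + A) * central m A" for m
    using gauss_pascal[of "2 * int m + 1" "int m + 1 - A"]
    by (simp add: h_def algebra_simps)
  have h_absorb: "(1 - (t ^ 2) ^ m) * h m = (1 - t powi (int m + A)) * central m A" for m
    using gauss_absorb[of "2 * int m" "int m - A"]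
    by (simp add: h_def algebra_simps power_int_def nat_mult_distrib flip: power_mult)
  have central_Suc': "central (Suc m) A = central m (A - 1) + (1 + t) * t powi (int m + A) * central m A
      + t powi (2 * int m + 2 + 2 * A) * central m (A + 1)" for m
  proof -
    have "central (Suc m) A = h (Suc m) + t powi (int m + 1 + A) * gauss_poly t (2 * int m + 1) (int m - A)"
      using gauss_pascal[of "2 * int m + 2" "int m + 1 - A"]
      by (simp add: h_def algebra_simps)
    also have "gauss_poly t (2 * int m + 1) (int m - A) = central m A + t powi (int m + 1 + A) * central m (A + 1)"
      using gauss_pascal[of "2 * int m + 1" "int m - A"]
      by (simp add: algebra_simps)
    also have "t powi (2 * int m + 2 + 2 * A) = t powi (int m + 1 + A) * t powi (int m + 1 + A)"
      using nonzero by (subst power_int_add[symmetric]) (auto intro!: arg_cong[of _ _ "power_int t"])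
    moreover have "t powi (int m + 1 + A) = t * t powi (int m + A)"
      using nonzero power_int_add[of t 1 "int m + A"] by (simp add: algebra_simps)
    ultimately show ?thesis unfolding h_Suc by (simp add: algebra_simps)
  qed
  have scale: "g * x = g * a + p * (g * b) + s * (g * c) - g * (w * d) + g * (w' * e)"
    if "x = a + p * b + s * c - w * d + w' * e" for x a b c d e g p s w w' :: 'a
    unfolding that by (simp add: algebra_simps)
  have "T0 (Suc L) A t =
      (\<Sum>r=0..L. ?g r * ((t ^ 2) ^ r * ((- 1) ^ r * central (Suc L - r) A) + (- 1) ^ Suc r * central (L - r) A))"
    unfolding T0_central pascal_rules(2) diff_Suc_Suc ..
  also have "\<dots> = (\<Sum>r=0..L. ?g r * ((- 1) ^ r * central (L - r) (A - 1))
      + t powi (int L + 1 + A) * (?g r * ((- t) ^ r * central (L - r) A))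
      + t powi (2 * int L + 2 + 2 * A) * (?g r * ((- 1) ^ r * central (L - r) (A + 1)))
      - ?g r * ((1 - (t ^ 2) ^ r) * ((- 1) ^ r * h (Suc L - r)))
      + ?g r * ((1 - (t ^ 2) ^ (L - r)) * ((- 1) ^ Suc r * h (L - r))))"
  proof (intro sum.cong refl)
    fix r assume "r \<in> {0..L}"
    then obtain m where L: "L = m + r" using nat_le_iff_add[of r L] by (auto simp: add.commute)
    have d: "Suc L - r = Suc m" "L - r = m" using L by auto
    define u v where "u = t powi (int m + A)" and "v = t powi (2 * int m + 2 + 2 * A)"
    have "int L + 1 + A = int (Suc r) + (int m + A)"
      and "2 * int L + 2 + 2 * A = int (r + r) + (2 * int m + 2 + 2 * A)"
      unfolding L by simp_all
    then have e1: "t powi (int L + 1 + A) = t * t ^ r * u"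
      and e2: "t powi (2 * int L + 2 + 2 * A) = t ^ r * t ^ r * v"
      unfolding u_def v_def using nonzero
      by (simp_all only: power_int_add power_int_of_nat power_Suc power_add simp_thms)
    have s: "(- t) ^ r = (- 1) ^ r * t ^ r" "(t ^ 2) ^ r = t ^ r * t ^ r"
      by (rule power_minus) (simp add: power2_eq_square power_mult_distrib)
    have a: "(1 - (t ^ 2) ^ m) * ((- 1) ^ Suc r * h m) = - ((- 1) ^ r * ((1 - u) * central m A))"
      using h_absorb[of m, folded u_def] by (simp add: mult.left_commute)
    have "(t ^ 2) ^ r * ((- 1) ^ r * central (Suc m) A) + (- 1) ^ Suc r * central m A =
        (- 1) ^ r * central m (A - 1)
      + t powi (int L + 1 + A) * ((- t) ^ r * central m A)
      + t powi (2 * int L + 2 + 2 * A) * ((- 1) ^ r * central m (A + 1))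
      - (1 - (t ^ 2) ^ r) * ((- 1) ^ r * h (Suc m))
      + (1 - (t ^ 2) ^ m) * ((- 1) ^ Suc r * h m)"
      unfolding a central_Suc' h_Suc e1 e2 s u_def[symmetric] v_def[symmetric] by (simp add: algebra_simps)
    then show "?g r * ((t ^ 2) ^ r * ((- 1) ^ r * central (Suc L - r) A) + (- 1) ^ Suc r * central (L - r) A) =
      ?g r * ((- 1) ^ r * central (L - r) (A - 1))
      + t powi (int L + 1 + A) * (?g r * ((- t) ^ r * central (L - r) A))
      + t powi (2 * int L + 2 + 2 * A) * (?g r * ((- 1) ^ r * central (L - r) (A + 1)))
      - ?g r * ((1 - (t ^ 2) ^ r) * ((- 1) ^ r * h (Suc L - r)))
      + ?g r * ((1 - (t ^ 2) ^ (L - r)) * ((- 1) ^ Suc r * h (L - r)))"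
      unfolding d by (rule scale)
  qed
  also have "\<dots> = T0 L (A - 1) t + t powi (int L + 1 + A) * T1 L A t
     + t powi (2 * int L + 2 + 2 * A) * T0 L (A + 1) t"
    using pascal_rules(3)[where L = L and f = "\<lambda>r. (- 1) ^ r * h (Suc L - r)"]
    unfolding sum.distrib sum_subtractf T1_central T0_central sum_distrib_left by simp
  finally show ?thesis .
qed

lemma T0_Suc':
  "T0 (Suc L) A t = T0 L (A + 1) t + t powi (int L + 1 - A) * T1 L A t
     + t powi (2 * int L + 2 - 2 * A) * T0 L (A - 1) t"
proof -
  have "- A - 1 = - (A + 1)" "- A + 1 = - (A - 1)" by simp_all
  then show ?thesis
    using T0_Suc[of L "- A"] unfolding T0_minus T1_minus by (simp only: T0_minus) simp
qed

section \<open>Theta sums over period 7\<close>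

text \<open>
  A formal theta series with the values of \<open>F\<close> as coefficients.  Every relation needed for the
  bilateral sum only moves the linear coefficient \<open>e\<close> and the offset \<open>b\<close>, so that it becomes a
  linear equation between finitely many values of this functional.
\<close>
definition theta :: "int \<Rightarrow> int \<Rightarrow> (int \<Rightarrow> 'a) \<Rightarrow> 'a" where
  "theta e b F = Sum_any (\<lambda>k. t powi (21 * k ^ 2 + e * k) * F (7 * k + b))"

lemma theta_support:
  assumes "finite {A. F A \<noteq> 0}"
  shows "finite {k. t powi (21 * k ^ 2 + e * k) * F (7 * k + b) \<noteq> 0}"
proof (rule finite_subset)
  show "{k. t powi (21 * k ^ 2 + e * k) * F (7 * k + b) \<noteq> 0} \<subseteq> (\<lambda>k. 7 * k + b) -` {A. F A \<noteq> 0}"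
    by auto
  show "finite ((\<lambda>k. 7 * k + b) -` {A. F A \<noteq> 0})"
    using assms by (rule finite_vimageI) (auto simp: inj_on_def)
qed

text \<open>
  The coefficients in the recurrences for \<open>T0\<close> and \<open>T1\<close> are monomials \<open>c * t powi (m * A)\<close>.  Such a
  factor is absorbed into the linear coefficient of the exponent, because \<open>A = 7 * k + b\<close> is affine
  in the summation index.
\<close>
lemma theta_combine:
  assumes fin: "finite {A. F A \<noteq> 0}" "finite {A. G A \<noteq> 0}" "finite {A. H A \<noteq> 0}"
  shows "theta e b (\<lambda>A. F A + c * t powi (m * A) * G A + d * t powi (n * A) * H A) =
    theta e b F + c * t powi (m * b) * theta (e + 7 * m) b G + d * t powi (n * b) * theta (e + 7 * n) b H"
proof -
  let ?f = "\<lambda>e F k. t powi (21 * k ^ 2 + e * k) * F (7 * k + b)"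
  have shift: "t powi (21 * k ^ 2 + e * k) * t powi (m * (7 * k + b)) =
      t powi (m * b) * t powi (21 * k ^ 2 + (e + 7 * m) * k)" for k m
    using nonzero by (auto simp flip: power_int_add intro!: arg_cong[of _ _ "power_int t"])
      (simp add: algebra_simps)
  have eq: "t powi (21 * k ^ 2 + e * k) *
        (F (7 * k + b) + c * t powi (m * (7 * k + b)) * G (7 * k + b) + d * t powi (n * (7 * k + b)) * H (7 * k + b))
      = ?f e F k + c * t powi (m * b) * ?f (e + 7 * m) G k + d * t powi (n * b) * ?f (e + 7 * n) H k" for k
    using shift[of k m] shift[of k n] by (simp add: distrib_left mult.assoc[symmetric] mult.left_commute)
      (simp add: mult_ac)
  have scaled: "finite {k. c * ?f e F k \<noteq> 0}" if "finite {A. F A \<noteq> 0}" for c e F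
    using theta_support[OF that, of e b] by (rule rev_finite_subset) auto
  have added: "finite {k. ?f e F k + c * ?f e' G k \<noteq> 0}"
    if "finite {A. F A \<noteq> 0}" "finite {A. G A \<noteq> 0}" for c e e' F G
    using finite_UnI[OF theta_support[OF that(1), of e b] theta_support[OF that(2), of e' b]]
    by (rule rev_finite_subset) auto
  show ?thesis
    unfolding theta_def eq
    by (simp only: Sum_any.distrib[OF added scaled] Sum_any.distrib[OF theta_support scaled]
        Sum_any_right_distrib[OF theta_support] fin)
qed

text \<open>The substitution \<open>k \<mapsto> - k\<close>.\<close>
lemma theta_reflect:
  assumes even: "\<And>A. F (- A) = F A"
  shows "theta (- e) (- b) F = theta e b F"
proof -
  have "theta e b F = Sum_any ((\<lambda>k. t powi (21 * k ^ 2 + e * k) * F (7 * k + b)) \<circ> uminus)"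
    unfolding theta_def by (rule Sum_any.reindex_cong[of uminus]) (auto simp: bij_uminus)
  also have "\<dots> = theta (- e) (- b) F"
    using even[of "7 * k - b" for k] by (simp add: theta_def comp_def)
  finally show ?thesis ..
qed

text \<open>The substitution \<open>k \<mapsto> - 1 - k\<close>, which maps \<open>7 * k + b\<close> to \<open>- (7 * k + (7 - b))\<close>.\<close>
lemma theta_reflect_shift:
  assumes fin: "finite {A. F A \<noteq> 0}" and even: "\<And>A. F (- A) = F A"
  shows "t powi e * theta e b F = t ^ 21 * theta (42 - e) (7 - b) F"
proof -
  let ?h = "\<lambda>k :: int. - 1 - k"
  have inv: "?h \<circ> ?h = id" by auto
  have bij: "bij ?h"
    using o_bij[OF inv inv] .
  have "t powi e * theta e b F =
      t powi e * Sum_any ((\<lambda>k. t powi (21 * k ^ 2 + e * k) * F (7 * k + b)) \<circ> ?h)"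
    unfolding theta_def by (subst Sum_any.reindex_cong[OF bij refl]) (auto simp: comp_def)
  also have "\<dots> = Sum_any (\<lambda>k. t powi e * (t powi (21 * (- 1 - k) ^ 2 + e * (- 1 - k)) * F (7 * (- 1 - k) + b)))"
  proof -
    have "finite {k. t powi (21 * (- 1 - k) ^ 2 + e * (- 1 - k)) * F (7 * (- 1 - k) + b) \<noteq> 0}"
      using finite_vimageI[OF theta_support[OF fin, of e b] bij_is_inj[OF bij]] by (simp add: vimage_def)
    then show ?thesis by (simp only: Sum_any_right_distrib comp_def)
  qed
  also have "\<dots> = Sum_any (\<lambda>k. t ^ 21 * (t powi (21 * k ^ 2 + (42 - e) * k) * F (7 * k + (7 - b))))"
  proof (intro arg_cong[of _ _ Sum_any] ext)
    fix k
    have "e + (21 * (- 1 - k) ^ 2 + e * (- 1 - k)) = 21 + (21 * k ^ 2 + (42 - e) * k)"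
      by (simp add: algebra_simps power2_eq_square)
    then have "t powi e * t powi (21 * (- 1 - k) ^ 2 + e * (- 1 - k)) = t powi 21 * t powi (21 * k ^ 2 + (42 - e) * k)"
      using nonzero by (simp only: power_int_add[symmetric] simp_thms disj_not1)
    moreover have "F (7 * (- 1 - k) + b) = F (7 * k + (7 - b))"
      using even[of "7 * k + (7 - b)"] by (simp add: algebra_simps)
    ultimately show "t powi e * (t powi (21 * (- 1 - k) ^ 2 + e * (- 1 - k)) * F (7 * (- 1 - k) + b)) =
        t ^ 21 * (t powi (21 * k ^ 2 + (42 - e) * k) * F (7 * k + (7 - b)))"
      by (simp flip: mult.assoc)
  qed
  also have "\<dots> = t ^ 21 * theta (42 - e) (7 - b) F"
    unfolding theta_def by (rule Sum_any_right_distrib[symmetric, OF theta_support[OF fin]])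
  finally show ?thesis .
qed

lemma theta_single:
  assumes "\<And>k. k \<noteq> 0 \<Longrightarrow> F (7 * k + b) = 0"
  shows "theta e b F = F b"
proof -
  have "theta e b F = (\<Sum>k\<in>{0}. t powi (21 * k ^ 2 + e * k) * F (7 * k + b))"
    unfolding theta_def
  proof (rule Sum_any.expand_superset)
    show "{k. t powi (21 * k ^ 2 + e * k) * F (7 * k + b) \<noteq> 0} \<subseteq> {0}"
      using assms by auto
  qed simp
  then show ?thesis by simp
qed

definition theta0 :: "int \<Rightarrow> int \<Rightarrow> nat \<Rightarrow> 'a" where
  "theta0 e b L = theta e b (\<lambda>A. T0 L A t)"

definition theta1 :: "int \<Rightarrow> int \<Rightarrow> nat \<Rightarrow> 'a" where
  "theta1 e b L = theta e b (\<lambda>A. T1 L A t)"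

lemma support_T0: "finite {A. T0 L (A + i) t \<noteq> 0}"
proof (rule finite_subset)
  show "{A. T0 L (A + i) t \<noteq> 0} \<subseteq> {- int L - i..int L - i}"
  proof
    fix A assume "A \<in> {A. T0 L (A + i) t \<noteq> 0}"
    then have "\<not> int L < \<bar>A + i\<bar>" using T0_eq_0[of L "A + i"] by auto
    then show "A \<in> {- int L - i..int L - i}" by auto
  qed
qed simp

lemma support_T1: "finite {A. T1 L (A + i) t \<noteq> 0}"
proof (rule finite_subset)
  show "{A. T1 L (A + i) t \<noteq> 0} \<subseteq> {- int L - i..int L - i}"
  proof
    fix A assume "A \<in> {A. T1 L (A + i) t \<noteq> 0}"
    then have "\<not> int L < \<bar>A + i\<bar>" using T1_eq_0[of L "A + i"] by auto
    then show "A \<in> {- int L - i..int L - i}" by auto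
  qed
qed simp

lemmas supports = support_T0[of _ 0, simplified] support_T1[of _ 0, simplified]
  support_T0 support_T1 support_T0[of _ "- 1", simplified]

lemma theta_T_shift:
  "theta e b (\<lambda>A. T0 L (A + 1) t) = theta0 e (b + 1) L"
  "theta e b (\<lambda>A. T1 L (A + 1) t) = theta1 e (b + 1) L"
  "theta e b (\<lambda>A. T0 L (A - 1) t) = theta0 e (b - 1) L"
  by (simp_all add: theta0_def theta1_def theta_def algebra_simps)

lemma theta1_Suc:
  "theta1 e b (Suc L) = theta1 e b L + t powi (int L + 1 + b) * theta0 (e + 7) (b + 1) L
     + t powi (int L + 1 - b) * theta0 (e - 7) (b - 1) L"
proof -
  have F: "T1 (Suc L) A t = T1 L A t + t powi (int L + 1) * t powi (1 * A) * T0 L (A + 1) t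
      + t powi (int L + 1) * t powi (- 1 * A) * T0 L (A - 1) t" for A
    using nonzero unfolding T1_Suc by (simp flip: power_int_add)
  show ?thesis
    unfolding theta1_def[of _ _ "Suc L"] F theta_combine[OF supports(2,3,5)] theta_T_shift
    using nonzero by (simp add: theta0_def[of _ b] theta1_def[of _ b] flip: power_int_add)
qed

lemma theta0_Suc:
  "theta0 e b (Suc L) = theta0 e (b - 1) L + t powi (int L + 1 + b) * theta1 (e + 7) b L
     + t powi (2 * int L + 2 + 2 * b) * theta0 (e + 14) (b + 1) L"
proof -
  have F: "T0 (Suc L) A t = T0 L (A - 1) t + t powi (int L + 1) * t powi (1 * A) * T1 L A t
      + t powi (2 * int L + 2) * t powi (2 * A) * T0 L (A + 1) t" for A
    using nonzero unfolding T0_Suc by (simp flip: power_int_add)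
  show ?thesis
    unfolding theta0_def[of _ _ "Suc L"] F theta_combine[OF supports(5,2,3)] theta_T_shift
    using nonzero by (simp add: theta0_def[of _ b] theta1_def[of _ b] flip: power_int_add)
qed

lemma theta0_Suc':
  "theta0 e b (Suc L) = theta0 e (b + 1) L + t powi (int L + 1 - b) * theta1 (e - 7) b L
     + t powi (2 * int L + 2 - 2 * b) * theta0 (e - 14) (b - 1) L"
proof -
  have F: "T0 (Suc L) A t = T0 L (A + 1) t + t powi (int L + 1) * t powi (- 1 * A) * T1 L A t
      + t powi (2 * int L + 2) * t powi (- 2 * A) * T0 L (A - 1) t" for A
    using nonzero unfolding T0_Suc' by (simp flip: power_int_add)
  show ?thesis
    unfolding theta0_def[of _ _ "Suc L"] F theta_combine[OF supports(3,2,5)] theta_T_shift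
    using nonzero by (simp add: theta0_def[of _ b] theta1_def[of _ b] flip: power_int_add)
qed

lemma theta_exchange:
  "theta1 e b L + t powi (int L + b + 1) * theta0 (e + 7) (b + 1) L =
   theta1 e (b + 1) L + t powi (int L - b) * theta0 (e - 7) b L"
proof -
  \<comment> \<open>The vanishing third terms only serve to match the three-term shape of the linearity lemma.\<close>
  have F: "T1 L A t + t powi (int L + 1) * t powi (1 * A) * T0 L (A + 1) t
      + 0 * t powi (0 * A) * T0 L A t =
      T1 L (A + 1) t + t powi (int L) * t powi (- 1 * A) * T0 L A t + 0 * t powi (0 * A) * T0 L A t" for A
  proof -
    have "t powi (int L + 1) * t powi (1 * A) = t powi (int L + A + 1)"
      "t powi (int L) * t powi (- 1 * A) = t powi (int L - A)"
      using nonzero by (simp_all only: power_int_add[symmetric] simp_thms disj_not1) (simp_all add: algebra_simps)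
    then show ?thesis using T1_T0_exchange[of L A] by simp
  qed
  have "theta e b (\<lambda>A. T1 L A t + t powi (int L + 1) * t powi (1 * A) * T0 L (A + 1) t
      + 0 * t powi (0 * A) * T0 L A t) =
      theta e b (\<lambda>A. T1 L (A + 1) t + t powi (int L) * t powi (- 1 * A) * T0 L A t + 0 * t powi (0 * A) * T0 L A t)"
    unfolding F ..
  then show ?thesis
    unfolding theta_combine[OF supports(2,3,1)] theta_combine[OF supports(4,1,1)] theta_T_shift
    using nonzero
    by (simp add: theta0_def[of _ b] theta1_def[of _ b] algebra_simps flip: power_int_add del: power_int_of_nat)
qed

lemma theta_T_reflect_shift:
  "t ^ k * theta0 (21 + int k) b L = theta0 (21 - int k) (7 - b) L"
  "t ^ k * theta1 (21 + int k) b L = theta1 (21 - int k) (7 - b) L"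
proof -
  have "t powi (21 + int k) = t ^ 21 * t ^ k"
    using nonzero by (simp add: power_int_add)
  then show "t ^ k * theta0 (21 + int k) b L = theta0 (21 - int k) (7 - b) L"
    and "t ^ k * theta1 (21 + int k) b L = theta1 (21 - int k) (7 - b) L"
    using nonzero theta_reflect_shift[OF supports(1) T0_minus, of "21 + int k" b L]
      theta_reflect_shift[OF supports(2) T1_minus, of "21 + int k" b L]
    by (simp_all add: theta0_def theta1_def)
qed

lemma theta0_reflect: "theta0 (- e) (- b) L = theta0 e b L"
  unfolding theta0_def by (intro theta_reflect T0_minus)

definition S :: "nat \<Rightarrow> 'a" where
  "S L = theta1 1 0 L - t ^ 2 * theta1 13 2 L"

text \<open>
  The companion of \<open>S\<close> built from \<open>T0\<close>.  It is what remains of \<open>S (Suc L) - S L\<close> after the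
  cancellation in the next lemma, and it is what makes the system of recurrences close up.
\<close>
definition V :: "nat \<Rightarrow> 'a" where
  "V L = theta0 8 1 L - t ^ 4 * theta0 20 3 L"

lemma powi_nat_add:
  "t powi (int L + int k) = t ^ L * t ^ k \<and> t powi (int k + int L) = t ^ L * t ^ k"
  "t powi (2 * int L + int k) = (t ^ L) ^ 2 * t ^ k \<and>
    t powi (int k + 2 * int L) = (t ^ L) ^ 2 * t ^ k"
  using nonzero by (simp_all add: power_int_add power_int_mult mult.commute[of 2])

lemma powi_nat_diff:
  "t ^ k * t powi (int L - int k) = t ^ L"
  "t ^ k * t powi (2 * int L - int k) = (t ^ L) ^ 2"
  using nonzero by (simp_all add: power_int_diff power_int_mult mult.commute[of 2])

text \<open>
  Of the four \<open>T0\<close>-sums produced by the recurrence for \<open>T1\<close>, two are \<open>theta0 6 1 L\<close> (one of them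
  after \<open>k \<mapsto> - k\<close>) with opposite signs; the other two form \<open>V L\<close>.
\<close>
lemma S_Suc: "S (Suc L) = S L + t ^ Suc L * V L"
proof -
  have "theta1 1 0 (Suc L) = theta1 1 0 L + t ^ L * t * theta0 8 1 L + t ^ L * t * theta0 6 1 L"
    using theta1_Suc[of 1 0 L] theta0_reflect[of 6 1 L] powi_nat_add(1)[of L 1] by simp
  moreover have "t ^ 2 * theta1 13 2 (Suc L) =
      t ^ 2 * theta1 13 2 L + t ^ L * t ^ 5 * theta0 20 3 L + t ^ L * t * theta0 6 1 L"
  proof -
    have "t ^ 2 * t powi (int L - 1) = t ^ L * t"
      using powi_nat_diff(1)[of 1 L] by (simp add: power2_eq_square mult_ac)
    then show ?thesis
      using theta1_Suc[of 13 2 L] powi_nat_add(1)[of L 3]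
      by (simp add: distrib_left flip: mult.assoc)
  qed
  ultimately show ?thesis
    by (simp add: S_def V_def algebra_simps power_numeral_reduce)
qed

text \<open>
  The leading terms of the recurrence for \<open>T0\<close> give \<open>V L\<close>.  The remaining four terms cancel: the
  exchange relation, followed by \<open>k \<mapsto> - 1 - k\<close>, maps one pair to the other.
\<close>
lemma V_from_next_level: "theta0 8 2 (Suc L) - t ^ 4 * theta0 20 4 (Suc L) = V L"
proof -
  define x where "x = t ^ L"
  have a1: "theta0 8 2 (Suc L) = theta0 8 1 L + x * t ^ 3 * theta1 15 2 L + x ^ 2 * t ^ 6 * theta0 22 3 L"
    using theta0_Suc[of 8 2 L] powi_nat_add(1)[of L 3] powi_nat_add(2)[of L 6] by (simp add: x_def)
  have a2: "theta0 20 4 (Suc L) = theta0 20 3 L + x * t ^ 5 * theta1 27 4 L + x ^ 2 * t ^ 10 * theta0 34 5 L"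
    using theta0_Suc[of 20 4 L] powi_nat_add(1)[of L 5] powi_nat_add(2)[of L 10] by (simp add: x_def)
  have "t ^ 2 * t powi (int L - 2) = x"
    using powi_nat_diff(1)[of 2 L] by (simp add: x_def)
  moreover have "t ^ 2 * (theta1 15 2 L + x * t ^ 3 * theta0 22 3 L) = t ^ 2 * (theta1 15 3 L + t powi (int L - 2) * theta0 8 2 L)"
    using theta_exchange[of 15 2 L] powi_nat_add(1)[of L 3] by (simp add: x_def)
  ultimately have r: "t ^ 2 * theta1 15 2 L + x * t ^ 5 * theta0 22 3 L = t ^ 2 * theta1 15 3 L + x * theta0 8 2 L"
    by (simp add: distrib_left power_numeral_reduce mult_ac)
  have m1: "t ^ 6 * theta1 27 4 L = theta1 15 3 L" and m2: "t ^ 13 * theta0 34 5 L = theta0 8 2 L"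
    using theta_T_reflect_shift(2)[of 6 4 L] theta_T_reflect_shift(1)[of 13 5 L] by simp_all
  let ?D = "x * t ^ 3 * theta1 15 2 L + x ^ 2 * t ^ 6 * theta0 22 3 L
      - t ^ 4 * (x * t ^ 5 * theta1 27 4 L + x ^ 2 * t ^ 10 * theta0 34 5 L)"
  have "t ^ 2 * ?D = x * t ^ 3 * ((t ^ 2 * theta1 15 2 L + x * t ^ 5 * theta0 22 3 L)
        - (t ^ 2 * (t ^ 6 * theta1 27 4 L) + x * (t ^ 13 * theta0 34 5 L)))"
    by (simp add: algebra_simps power_numeral_reduce)
  also have "\<dots> = 0"
    unfolding r m1 m2 by simp
  finally have "?D = 0"
    using nonzero by simp
  then show ?thesis
    unfolding a1 a2 V_def by (simp add: algebra_simps)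
qed

text \<open>
  Going down two levels, first with \<open>theta0_Suc\<close> and then with \<open>theta0_Suc'\<close>, shifts the offset by
  \<open>-1\<close> and then by \<open>+1\<close>, so the leading terms reproduce \<open>V L\<close>; the lower-order terms contribute
  \<open>t ^ Suc L * S L\<close> and two pairs at level \<open>Suc L\<close>.  The exchange relation turns these pairs into
  \<open>V (Suc L)\<close> and a difference \<open>theta1 15 2 - theta1 15 3\<close>, which by the exchange relation again is
  a multiple of the left-hand side of the preceding lemma.
\<close>
lemma V_Suc_Suc: "V (Suc (Suc L)) = V L + t ^ Suc L * S (Suc (Suc L))"
proof -
  define x where "x = t ^ L"
  let ?M = "Suc L"
  have a1: "theta0 8 1 (Suc ?M) = theta0 8 0 ?M + x * t ^ 3 * theta1 15 1 ?M + x ^ 2 * t ^ 6 * theta0 22 2 ?M"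
    using theta0_Suc[of 8 1 ?M] powi_nat_add(1)[of L 3] powi_nat_add(2)[of L 6] by (simp add: x_def)
  have a2: "theta0 20 3 (Suc ?M) = theta0 20 2 ?M + x * t ^ 5 * theta1 27 3 ?M + x ^ 2 * t ^ 10 * theta0 34 4 ?M"
    using theta0_Suc[of 20 3 ?M] powi_nat_add(1)[of L 5] powi_nat_add(2)[of L 10] by (simp add: x_def)
  have a3: "theta0 8 0 ?M = theta0 8 1 L + x * t * theta1 1 0 L + x ^ 2 * t ^ 2 * theta0 6 1 L"
    using theta0_Suc'[of 8 0 L] theta0_reflect[of 6 1 L] powi_nat_add(1)[of L 1] powi_nat_add(2)[of L 2]
    by (simp add: x_def)
  have "t ^ 4 * t powi (int L - 1) = t ^ 3 * (t ^ 1 * t powi (int L - int 1))"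
    "t ^ 4 * t powi (2 * int L - 2) = t ^ 2 * (t ^ 2 * t powi (2 * int L - int 2))"
    by (simp_all add: power_numeral_reduce)
  then have p: "t ^ 4 * t powi (int L - 1) = x * t ^ 3" "t ^ 4 * t powi (2 * int L - 2) = x ^ 2 * t ^ 2"
    unfolding powi_nat_diff x_def by simp_all
  have "theta0 20 2 ?M = theta0 20 3 L + t powi (int L - 1) * theta1 13 2 L + t powi (2 * int L - 2) * theta0 6 1 L"
    using theta0_Suc'[of 20 2 L] by simp
  then have a4: "t ^ 4 * theta0 20 2 ?M = t ^ 4 * theta0 20 3 L + x * t ^ 3 * theta1 13 2 L + x ^ 2 * t ^ 2 * theta0 6 1 L"
    by (simp add: distrib_left mult.assoc[symmetric] p)
  have r1: "theta1 15 1 ?M + x * t ^ 3 * theta0 22 2 ?M = theta1 15 2 ?M + x * theta0 8 1 ?M"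
    using theta_exchange[of 15 1 ?M] powi_nat_add(1)[of L 3] by (simp add: x_def)
  have "t ^ 6 * t powi (int L - 2) = t ^ 4 * (t ^ 2 * t powi (int L - int 2))"
    by (simp add: power_numeral_reduce)
  then have p': "t ^ 6 * t powi (int L - 2) = x * t ^ 4"
    unfolding powi_nat_diff x_def by simp
  have "theta1 27 3 ?M + x * t ^ 5 * theta0 34 4 ?M = theta1 27 4 ?M + t powi (int L - 2) * theta0 20 3 ?M"
    using theta_exchange[of 27 3 ?M] powi_nat_add(1)[of L 5] by (simp add: x_def)
  then have "t ^ 6 * (theta1 27 3 ?M + x * t ^ 5 * theta0 34 4 ?M) = t ^ 6 * theta1 27 4 ?M + x * t ^ 4 * theta0 20 3 ?M"
    by (simp add: distrib_left mult.assoc[symmetric] p')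
  moreover have "t ^ 6 * theta1 27 4 ?M = theta1 15 3 ?M" and m: "t * theta0 22 3 ?M = theta0 20 4 ?M"
    using theta_T_reflect_shift(2)[of 6 4 ?M] theta_T_reflect_shift(1)[of 1 3 ?M] by simp_all
  ultimately have r2: "t ^ 6 * (theta1 27 3 ?M + x * t ^ 5 * theta0 34 4 ?M) = theta1 15 3 ?M + x * t ^ 4 * theta0 20 3 ?M"
    by simp
  have "theta1 15 2 ?M + x * t ^ 4 * theta0 22 3 ?M = theta1 15 3 ?M + t powi (int L - 1) * theta0 8 2 ?M"
    using theta_exchange[of 15 2 ?M] powi_nat_add(1)[of L 4] by (simp add: x_def)
  then have "t * (theta1 15 2 ?M + x * t ^ 4 * theta0 22 3 ?M) = t * (theta1 15 3 ?M + t powi (int L - 1) * theta0 8 2 ?M)"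
    by simp
  moreover have "t * t powi (int L - 1) = x"
    using powi_nat_diff(1)[of 1 L] by (simp add: x_def)
  ultimately have "t * theta1 15 2 ?M + x * t ^ 4 * (t * theta0 22 3 ?M) = t * theta1 15 3 ?M + x * theta0 8 2 ?M"
    by (simp add: distrib_left mult_ac)
  then have z: "t * (theta1 15 2 ?M - theta1 15 3 ?M) = x * V L"
    unfolding m V_from_next_level[symmetric] by (simp add: algebra_simps)
  have "V (Suc ?M) = V L + x * t * S L
      + x * t ^ 3 * ((theta1 15 1 ?M + x * t ^ 3 * theta0 22 2 ?M) - t ^ 6 * (theta1 27 3 ?M + x * t ^ 5 * theta0 34 4 ?M))"
    using a4 unfolding V_def[of "Suc ?M"] V_def[of L] S_def a1 a2 a3
    by (simp add: algebra_simps power_numeral_reduce)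
  also have "\<dots> = V L + x * t * S L + x * t ^ 2 * (t * (theta1 15 2 ?M - theta1 15 3 ?M) + x * t * V ?M)"
    unfolding r1 r2 V_def[of ?M] by (simp add: algebra_simps power_numeral_reduce)
  also have "\<dots> = V L + t ^ Suc L * S (Suc (Suc L))"
    unfolding z S_Suc[of ?M] S_Suc[of L] by (simp add: x_def algebra_simps power_numeral_reduce)
  finally show ?thesis .
qed

lemma T_0: "T0 0 A t = (if A = 0 then 1 else 0)" "T1 0 A t = (if A = 0 then 1 else 0)"
  by (auto simp: T0_def T1_def gauss_poly_def qpochhammer_def)

lemma S_V_initial: "S 0 = 1" "V 0 = 0" "V 1 = 1"
proof -
  have "7 * k + 2 \<noteq> 0" "7 * k + 1 \<noteq> 0" "7 * k + 3 \<noteq> 0" for k :: int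
    by presburger+
  then have "theta1 1 0 0 = 1" "theta1 13 2 0 = 0" "theta0 8 1 0 = 0" "theta0 20 3 0 = 0"
    unfolding theta0_def theta1_def by (subst theta_single; simp add: T_0)+
  then show "S 0 = 1" "V 0 = 0"
    by (simp_all add: S_def V_def)
  have "T0 1 1 t = 1"
    using T0_Suc[of 0 1] by (simp add: T_0)
  moreover have "theta0 8 1 1 = T0 1 1 t" "theta0 20 3 1 = T0 1 3 t"
    unfolding theta0_def by (rule theta_single, rule T0_eq_0, presburger)+
  ultimately show "V 1 = 1"
    by (simp add: V_def T0_eq_0)
qed

text \<open>
  Multiplying \<open>V_Suc_Suc\<close> by a power of \<open>t\<close> and replacing every \<open>V\<close> by a difference of
  consecutive values of \<open>S\<close> eliminates \<open>V\<close>.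
\<close>
lemma S_recurrence:
  assumes "3 \<le> n"
  shows "S (n + 1) = (1 + (t ^ 2) ^ n) * S n + t ^ 2 * S (n - 1) - t ^ 2 * S (n - 2)"
proof -
  obtain L where n: "n = Suc (Suc L)"
    using assms by (metis add_2_eq_Suc le_Suc_ex numeral_3_eq_3 Suc_le_D Suc_le_mono)
  show ?thesis
    unfolding n using S_Suc[of "Suc (Suc L)"] S_Suc[of L] V_Suc_Suc[of L]
    by (simp add: algebra_simps power2_eq_square flip: power_mult_distrib)
qed

lemma S_small: "S 1 = 1" "S 2 = 1 + t ^ 2" "S 3 = (1 + t ^ 4) * (1 + t ^ 2)"
proof -
  show S1: "S 1 = 1"
    using S_Suc[of 0] S_V_initial by simp
  show S2: "S 2 = 1 + t ^ 2"
    using S_Suc[of 1] S_V_initial S1 by (simp add: numeral_2_eq_2)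
  show "S 3 = (1 + t ^ 4) * (1 + t ^ 2)"
    using S_Suc[of 2] V_Suc_Suc[of 0] S_V_initial S2
    by (simp add: eval_nat_numeral algebra_simps)
qed

section \<open>The double sum\<close>

lemma gauss_0: "0 \<le> A \<Longrightarrow> gauss_poly t A 0 = 1"
proof -
  have "1 - t * t ^ i \<noteq> 0" for i
    using power_neq_1[of "Suc i"] by auto
  then show "gauss_poly t A 0 = 1" if "0 \<le> A"
    using that by (simp add: gauss_poly_def) (simp add: qpochhammer_def)
qed

text \<open>
  The coefficient form of \<open>(1 - w) C(j+1, w) = C(j, t w)\<close> for \<open>C(j, w) = 1 / (w;t)_j\<close>, the
  generating function of \<open>Pfactor t j\<close>.  For \<open>j = 0\<close> its constant coefficient is the exceptional
  value \<open>Pfactor t 0 0 = 1\<close>.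
\<close>
lemma Pfactor_diff:
  "Pfactor t (Suc j) (Suc k) - Pfactor t (Suc j) k = t ^ Suc k * Pfactor t j (Suc k)"
  using gauss_pascal'[of "int j + int k + 1" "int k + 1"] power_int_of_nat[of t "Suc k"]
  by (simp add: Pfactor_def algebra_simps)

lemma Pfactor_k0: "Pfactor t j 0 = 1"
  by (cases j) (simp_all add: Pfactor_def gauss_0)

text \<open>
  The coefficient form of \<open>(1 - z) B(j+1, z) = z t^(-j) B(j, t z)\<close> for \<open>B(j, z) = z^j / (z;t)_(j+1)\<close>.
  Both sides vanish at \<open>m \<le> 0\<close>, so no boundary term arises.
\<close>
lemma gauss_diff:
  "gauss_poly t m (1 + int j) - gauss_poly t (m - 1) (1 + int j) =
     t powi (m - 1 - int j) * gauss_poly t (m - 1) (int j)"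
proof (cases "0 < m")
  case True
  then show ?thesis
    using gauss_pascal[of m "1 + int j"] by (simp add: algebra_simps)
qed (simp add: gauss_poly_eq_0)

text \<open>
  For \<open>m \<le> int N\<close> this is the coefficient of \<open>z^m\<close> in \<open>z^j / ((z;t)_(j+1) (t z^2;t^2)_j)\<close>.  The common
  cutoff \<open>N\<close> allows values at different \<open>m\<close> to be subtracted termwise, and the integer argument
  makes coefficients at negative exponents available.
\<close>
definition column :: "nat \<Rightarrow> nat \<Rightarrow> int \<Rightarrow> 'a" where
  "column N j m = (\<Sum>k=0..N. t ^ k * Pfactor (t ^ 2) j k * gauss_poly t (m - 2 * int k) (int j))"

lemmas Pfactor_rules = generic_base.Pfactor_diff[OF generic_base_square]
  generic_base.Pfactor_k0[OF generic_base_square]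

lemma column_eq_0: "m < int j \<Longrightarrow> column N j m = 0"
  unfolding column_def by (rule sum.neutral) (simp add: gauss_poly_eq_0)

lemma column_0: "column N 0 m = (if 0 \<le> m then 1 else 0)"
proof -
  have "Pfactor (t ^ 2) 0 k = (if k = 0 then 1 else 0)" for k
    by (simp add: Pfactor_def gauss_poly_eq_0)
  then have "column N 0 m = (\<Sum>k=0..N. if k = 0 then gauss_poly t m 0 else 0)"
    unfolding column_def by (intro sum.cong) auto
  then show ?thesis
    by (simp add: gauss_0 gauss_poly_eq_0)
qed

text \<open>
  The coefficient form of \<open>(1 - z) (1 - t z^2) H(j+1, z) = z t^(-j) H(j, z t)\<close>, where \<open>H(j, z)\<close> is
  the generating function of \<open>column N j\<close>.
\<close>
lemma column_Suc:
  assumes "m \<le> int N"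
  shows "column N (Suc j) m - column N (Suc j) (m - 1)
      - t * (column N (Suc j) (m - 2) - column N (Suc j) (m - 3))
    = t powi (m - 1 - int j) * column N j (m - 1)"
proof -
  define X where "X i = t powi (i - 1 - int j) * gauss_poly t (i - 1) (int j)" for i
  let ?c = "Pfactor (t ^ 2)"
  have diff: "column N (Suc j) i - column N (Suc j) (i - 1)
      = (\<Sum>k=0..N. t ^ k * ?c (Suc j) k * X (i - 2 * int k))" for i
    unfolding column_def sum_subtractf[symmetric]
  proof (intro sum.cong refl)
    fix k
    have swap: "i - 1 - 2 * int k = i - 2 * int k - 1"
      by simp
    show "t ^ k * ?c (Suc j) k * gauss_poly t (i - 2 * int k) (int (Suc j)) -
        t ^ k * ?c (Suc j) k * gauss_poly t (i - 1 - 2 * int k) (int (Suc j)) =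
        t ^ k * ?c (Suc j) k * X (i - 2 * int k)"
      unfolding swap by (simp add: X_def gauss_diff[symmetric] right_diff_distrib)
  qed
  \<comment> \<open>Summation by parts; the boundary term has a negative upper index once \<open>M = N\<close>.\<close>
  have "(\<Sum>k=0..M. t ^ k * ?c (Suc j) k * X (m - 2 * int k))
      - t * (\<Sum>k=0..M. t ^ k * ?c (Suc j) k * X (m - 2 - 2 * int k))
    = (\<Sum>k=0..M. t ^ k * (t ^ 2) ^ k * ?c j k * X (m - 2 * int k))
      - t ^ Suc M * ?c (Suc j) M * X (m - 2 - 2 * int M)" for M
  proof (induction M)
    case (Suc M)
    have "?c (Suc j) (Suc M) = ?c (Suc j) M + (t ^ 2) ^ Suc M * ?c j (Suc M)"
      using Pfactor_rules(1)[of j M] by (simp add: algebra_simps)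
    with Suc show ?case by (simp add: algebra_simps)
  qed (simp add: Pfactor_rules)
  moreover have "X (m - 2 - 2 * int N) = 0"
    using assms by (simp add: X_def gauss_poly_eq_0)
  moreover have "(t ^ 2) ^ k * X (m - 2 * int k) =
      t powi (m - 1 - int j) * gauss_poly t (m - 1 - 2 * int k) (int j)" for k
  proof -
    have "(t ^ 2) ^ k * t powi (m - 2 * int k - 1 - int j) = t powi (2 * int k + (m - 2 * int k - 1 - int j))"
      using nonzero by (subst power_int_add) (auto simp: power_int_mult)
    then show ?thesis by (simp add: X_def algebra_simps)
  qed
  then have "(\<Sum>k=0..N. t ^ k * (t ^ 2) ^ k * ?c j k * X (m - 2 * int k)) = t powi (m - 1 - int j) * column N j (m - 1)"
    unfolding column_def sum_distrib_left by (intro sum.cong) (simp_all add: mult_ac)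
  ultimately show ?thesis
    using diff[of m] diff[of "m - 2"] by simp
qed

definition P_trunc :: "nat \<Rightarrow> int \<Rightarrow> 'a" where
  "P_trunc N m = (\<Sum>j=0..N. t ^ (j * (j + 1) div 2) * column N j m)"

lemma P_trunc_neg: "m < 0 \<Longrightarrow> P_trunc N m = 0"
  unfolding P_trunc_def by (rule sum.neutral) (simp add: column_eq_0)

lemma P_eq_P_trunc:
  assumes "n \<le> N" shows "P t n = P_trunc N (int n)"
proof -
  have "Sum_any (\<lambda>k. Pterm t n j k) = (\<Sum>k=0..N. Pterm t n j k)" for j
    using assms by (intro Sum_any.expand_superset) (auto intro!: leI dest: Pterm_eq_0[rotated] simp: Pterm_eq_0)
  then have inner: "Sum_any (\<lambda>k. Pterm t n j k) = t ^ (j * (j + 1) div 2) * column N j (int n)" for j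
    by (simp add: column_def Pterm_def sum_distrib_left power_add mult_ac)
  show ?thesis
    unfolding P_def inner P_trunc_def
    using assms column_eq_0[of "int n" _ N] by (intro Sum_any.expand_superset) (auto intro!: leI)
qed

text \<open>
  The inhomogeneous terms come from the summand \<open>j = 0\<close>, where
  \<open>(1 - z) (1 - t z^2) / (1 - z) = 1 - t z^2\<close>.  With them the recurrence starts from the zero values
  at negative \<open>m\<close> and produces the three initial values.
\<close>
lemma P_trunc_recurrence:
  assumes "m \<le> int N" "0 \<le> m"
  shows "P_trunc N m = (1 + t powi m) * P_trunc N (m - 1) + t * P_trunc N (m - 2) - t * P_trunc N (m - 3)
    + (if m = 0 then 1 else 0) - (if m = 2 then t else 0)"
proof -
  let ?w = "\<lambda>j. t ^ (j * (j + 1) div 2)"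
  let ?D = "\<lambda>f. f m - f (m - 1) - t * (f (m - 2) - f (m - 3))"
  have w: "?w (Suc j) * t powi (m - 1 - int j) = t powi m * ?w j" for j
  proof -
    have "Suc j * (Suc j + 1) div 2 = Suc j + j * (j + 1) div 2"
      by (simp add: algebra_simps)
    then have "?w (Suc j) * t powi (m - 1 - int j) = ?w j * (t powi int (Suc j) * t powi (m - 1 - int j))"
      by (simp add: power_add del: of_nat_Suc)
    also have "t powi int (Suc j) * t powi (m - 1 - int j) = t powi m"
      using nonzero by (simp flip: power_int_add)
    finally show ?thesis by (simp add: mult.commute)
  qed
  have "?D (P_trunc N) = (\<Sum>j=0..N. ?w j * ?D (column N j))"
    unfolding P_trunc_def by (simp add: sum_distrib_left sum_subtractf[symmetric] algebra_simps)
  also have "\<dots> = ?D (column N 0) + (\<Sum>j=0..<N. ?w (Suc j) * ?D (column N (Suc j)))"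
    by (simp add: sum.atLeast0_atMost_Suc_shift sum.atLeast_Suc_atMost atLeast0AtMost sum.atMost_shift lessThan_atLeast0)
  also have "(\<Sum>j=0..<N. ?w (Suc j) * ?D (column N (Suc j))) = (\<Sum>j=0..<N. t powi m * (?w j * column N j (m - 1)))"
    unfolding column_Suc[OF assms(1)] by (simp only: mult.assoc[symmetric] w)
  also have "\<dots> = t powi m * P_trunc N (m - 1)"
    using assms(1) column_eq_0[of "m - 1" N N]
    by (simp add: P_trunc_def sum_distrib_left sum.last_plus)
  also have "?D (column N 0) = (if m = 0 then 1 else 0) - (if m = 2 then t else 0)"
    using assms(2) by (auto simp: column_0)
  finally show ?thesis by (simp add: algebra_simps)
qed

lemma P_recurrence:
  assumes "3 \<le> n"
  shows "P t n = (1 + t ^ n) * P t (n - 1) + t * P t (n - 2) - t * P t (n - 3)"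
  using P_trunc_recurrence[of "int n" n] assms
    P_eq_P_trunc[of n n] P_eq_P_trunc[of "n - 1" n] P_eq_P_trunc[of "n - 2" n] P_eq_P_trunc[of "n - 3" n]
  by (simp add: of_nat_diff)

lemma P_small: "P t 0 = 1" "P t 1 = t + 1" "P t 2 = t ^ 3 + t ^ 2 + t + 1"
proof -
  have "P_trunc 2 0 = 1"
    using P_trunc_recurrence[of 0 2] by (simp add: P_trunc_neg)
  moreover from this have "P_trunc 2 1 = t + 1"
    using P_trunc_recurrence[of 1 2] by (simp add: P_trunc_neg)
  moreover from calculation have "P_trunc 2 2 = t ^ 3 + t ^ 2 + t + 1"
    using P_trunc_recurrence[of 2 2] by (simp add: P_trunc_neg algebra_simps eval_nat_numeral)
  ultimately show "P t 0 = 1" "P t 1 = t + 1" "P t 2 = t ^ 3 + t ^ 2 + t + 1"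
    using P_eq_P_trunc[of 0 2] P_eq_P_trunc[of 1 2] P_eq_P_trunc[of 2 2] by simp_all
qed

section \<open>Identification of the two sides\<close>

lemma bilateral_sum:
  "Sum_any (\<lambda>k::int. (t ^ 2) powi ((21 * k ^ 2 + k) div 2) * T1 L (7 * k) t
      - (t ^ 2) powi ((21 * k ^ 2 + 13 * k + 2) div 2) * T1 L (7 * k + 2) t) = S L"
proof -
  have half: "(t ^ 2) powi (a div 2) = t powi a" if "even a" for a
  proof -
    have "(t ^ 2) powi (a div 2) = t powi (2 * (a div 2))"
      using power_int_mult[of t 2 "a div 2"] by simp
    with that show ?thesis by simp
  qed
  have h1: "(t ^ 2) powi ((21 * k ^ 2 + k) div 2) = t powi (21 * k ^ 2 + 1 * k)" for k
    by (subst half) auto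
  have h2: "(t ^ 2) powi ((21 * k ^ 2 + 13 * k + 2) div 2) = t ^ 2 * t powi (21 * k ^ 2 + 13 * k)" for k
    using nonzero by (subst half) (auto simp: power_int_add)
  have fin: "finite {A. T1 L A t \<noteq> 0}"
    by (rule supports)
  have scale: "Sum_any (\<lambda>k. - (t ^ 2) * (t powi (21 * k ^ 2 + 13 * k) * T1 L (7 * k + 2) t)) =
      - (t ^ 2) * Sum_any (\<lambda>k. t powi (21 * k ^ 2 + 13 * k) * T1 L (7 * k + 2) t)"
    by (rule Sum_any_right_distrib[symmetric, OF theta_support[OF fin]])
  have "finite {k. - (t ^ 2) * (t powi (21 * k ^ 2 + 13 * k) * T1 L (7 * k + 2) t) \<noteq> 0}"
    using theta_support[OF fin, of 13 2] by (rule rev_finite_subset) auto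
  then have "S L = Sum_any (\<lambda>k. t powi (21 * k ^ 2 + 1 * k) * T1 L (7 * k + 0) t
      + - (t ^ 2) * (t powi (21 * k ^ 2 + 13 * k) * T1 L (7 * k + 2) t))"
    by (subst Sum_any.distrib[OF theta_support[OF fin]], assumption)
      (simp only: scale, simp only: S_def theta1_def theta_def add_0_right diff_conv_add_uminus mult_minus_left)
  then show ?thesis
    unfolding h1 h2 by (simp add: mult.assoc)
qed

lemma P_eq_S: "P (t ^ 2) n = S (n + 1)"
proof (induction n rule: less_induct)
  case (less n)
  have small: "P (t ^ 2) 0 = S 1" "P (t ^ 2) 1 = S 2" "P (t ^ 2) 2 = S 3"
    unfolding generic_base.P_small[OF generic_base_square] S_small
    by (simp_all add: algebra_simps flip: power_mult power_add)
  consider "n = 0" | "n = 1" | "n = 2" | "3 \<le> n" by linarith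
  then show ?case
  proof cases
    case 4
    then obtain m where m: "n = Suc (Suc (Suc m))"
      by (metis Suc_le_D Suc_le_mono numeral_3_eq_3)
    have "P (t ^ 2) (n - 1) = S n" "P (t ^ 2) (n - 2) = S (n - 1)" "P (t ^ 2) (n - 3) = S (n - 2)"
      using less[of "n - 1"] less[of "n - 2"] less[of "n - 3"] by (simp_all add: m)
    then show ?thesis
      unfolding generic_base.P_recurrence[OF generic_base_square 4] S_recurrence[OF 4] by simp
  qed (use small in \<open>simp_all flip: numeral_2_eq_2\<close>)
qed

end

lemma generic_base_sqrt_q: "generic_base sqrt_q"
proof
  have power: "sqrt_q ^ n = Fract (monom 1 n) 1" for n
    by (induction n) (simp_all add: sqrt_q_def One_fract_def monom_Suc)
  show "sqrt_q \<noteq> 0"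
    by (simp add: sqrt_q_def Zero_fract_def eq_fract)
  show "sqrt_q ^ n \<noteq> 1" if "0 < n" for n
    using that unfolding power One_fract_def by (simp add: eq_fract monom_eq_1_iff)
qed

interpretation sqrt_q: generic_base sqrt_q
  by (rule generic_base_sqrt_q)

interpretation q: generic_base q_ind
  unfolding q_ind_def by (rule sqrt_q.generic_base_square)

theorem mainTheorem16:
  shows "(\<forall>n::nat. P q_ind n =
            Sum_any (\<lambda>k::int.
                q_ind powi ((21 * k ^ 2 + k) div 2) * T1 (n + 1) (7 * k) sqrt_q
              - q_ind powi ((21 * k ^ 2 + 13 * k + 2) div 2) * T1 (n + 1) (7 * k + 2) sqrt_q))
       \<and> P q_ind 0 = 1
       \<and> P q_ind 1 = q_ind + 1
       \<and> P q_ind 2 = q_ind ^ 3 + q_ind ^ 2 + q_ind + 1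
       \<and> (\<forall>n::nat. 3 \<le> n \<longrightarrow>
            P q_ind n = (1 + q_ind ^ n) * P q_ind (n - 1) + q_ind * P q_ind (n - 2) - q_ind * P q_ind (n - 3))"
  using sqrt_q.P_eq_S sqrt_q.bilateral_sum q.P_small q.P_recurrence
  by (simp add: q_ind_def)

end
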